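(* Let $j\ge 4$ be an integer, and write $\rho_i=\rho_i(F_j,1)$ for the residue of $F_i$ modulo $F_j$ with $0\le\rho_i\le F_j-1$. (i) If $j$ is even, then $\pi(F_j,1)=2j$ and the values of $\rho_i$ for $i\in\{0,\ldots,2j-1\}$ are (i.1) $\rho_i=F_i$ if $i<j$; (i.2) $\rho_i=0$ if $i=j$; (i.3) $\rho_i=F_{2j-i}$ if $j<i<2j$ and $i$ is odd; (i.4) $\rho_i=F_j-F_{2j-i}$ if $j<i<2j$ and $i$ is even. (ii) If $j$ is odd, then $\pi(F_j,1)=4j$ and the values of $\rho_i$ for $i\in\{0,\ldots,4j-1\}$ are (ii.1) $\rho_i=F_i$ if $i<j$; (ii.2) $\rho_i=0$ if $i=j$; (ii.3) $\rho_i=F_{2j-i}$ if $j<i<2j$ and $i$ is even; (ii.4) $\rho_i=F_j-F_{2j-i}$ if $j<i<2j$ and $i$ is odd; (ii.5) $\rho_i=0$ if $i=2j$; (ii.6) $\rho_i=F_j-F_{i-2j}$ if $2j<i<3j$; (ii.7) $\rho_i=0$ if $i=3j$; (ii.8) $\rho_i=F_j-F_{4j-i}$ if $3j<i<4j$ and $i$ is even; (ii.9) $\rho_i=F_{4j-i}$ if $3j<i<4j$ and $i$ is odd.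
   Context: The Fibonacci numbers are $F_0=0$, $F_1=1$, $F_{i+1}=F_i+F_{i-1}$ for $i\ge 1$. For integers $j\ge 1$, $e\ge 1$, $\rho_i(F_j,e)$ is the integer with $\rho_i(F_j,e)\equiv F_i^e\pmod{F_j}$ and $0\le\rho_i(F_j,e)\le F_j-1$. A sequence $(a_i:i\ge 0)$ is periodic if there is an integer $p\ge 1$, called a period, with $a_{i+p}=a_i$ for all $i\ge 0$. $\pi(F_j,e)$ denotes the periodicity, i.e. the minimum period, of the sequence $\mathcal{F}^e(F_j)=(F_i^e \bmod F_j: i\ge 0)$. *)

theory Defs
  imports "HOL-Number_Theory.Fib"
begin

(* rho i m e is the residue of F_i^e modulo m, used with m = F_j.  It is an integer, so that the
   differences F_j - F_k in results about it are not truncated. *)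
definition rho :: "nat \<Rightarrow> nat \<Rightarrow> nat \<Rightarrow> int" where
  "rho i m e = int (fib i) ^ e mod int m"

definition is_period :: "(nat \<Rightarrow> 'a) \<Rightarrow> nat \<Rightarrow> bool" where
  "is_period a p \<longleftrightarrow> p \<ge> 1 \<and> (\<forall>i. a (i + p) = a i)"

definition periodic :: "(nat \<Rightarrow> 'a) \<Rightarrow> bool" where
  "periodic a \<longleftrightarrow> (\<exists>p. is_period a p)"

(* Only meaningful for periodic sequences. *)
definition min_period :: "(nat \<Rightarrow> 'a) \<Rightarrow> nat" where
  "min_period a = (LEAST p. is_period a p)"

lemma is_period_min_period: "periodic a \<Longrightarrow> is_period a (min_period a)"
  unfolding periodic_def min_period_def by (auto intro: LeastI)

definition fib_period :: "nat \<Rightarrow> nat \<Rightarrow> nat" where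
  "fib_period m e = min_period (\<lambda>i. rho i m e)"

end

theory Submission
  imports Defs "HOL-Number_Theory.Cong"
begin

text \<open>
  Running the recursion symmetrically in both directions from the index \<open>j\<close>, where the sequence
  vanishes modulo \<open>F\<^sub>j\<close>, gives \<open>F\<^sub>j\<^sub>+\<^sub>k \<equiv> (-1)\<^sup>k\<^sup>+\<^sup>1 F\<^sub>j\<^sub>-\<^sub>k\<close> for \<open>k \<le> j\<close>. At \<open>k = j\<close> and
  \<open>k = j - 1\<close> this supplies the initial values that yield \<open>F\<^sub>2\<^sub>j\<^sub>+\<^sub>k \<equiv> (-1)\<^sup>j F\<^sub>k\<close> for all \<open>k\<close>.
  All residues are then determined. They vanish only at multiples of \<open>j\<close>, so a period is a
  multiple of \<open>j\<close>, and the residue following the zero (which must be 1) excludes the multiples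
  that are too small.
\<close>

text \<open>Otherwise the exponent 1 in \<open>rho i m 1\<close> is rewritten to \<open>Suc 0\<close> and blocks the rewrite rules below.\<close>
declare One_nat_def [simp del]

section \<open>Congruences modulo \<open>fib j\<close> and size bounds\<close>

lemma fib_reflect_cong:
  "k \<le> j \<Longrightarrow> [int (fib (j + k)) = (-1) ^ Suc k * int (fib (j - k))] (mod int (fib j))"
proof (induction k rule: fib.induct)
  case 1
  then show ?case by (simp add: cong_iff_dvd_diff)
next
  case 2
  then obtain m where "j = Suc m" by (cases j) auto
  then show ?case by (cases m) (simp_all add: cong_iff_dvd_diff)
next
  case (3 k)
  then obtain m where m: "j - k = Suc (Suc m)" "j - Suc k = Suc m" "j - Suc (Suc k) = m"
    by (metis Suc_diff_Suc Suc_le_lessD Suc_lessD)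
  have "[int (fib (j + Suc k)) = (-1) ^ Suc (Suc k) * int (fib (Suc m))] (mod int (fib j))"
    using 3(1)[OF Suc_leD[OF 3(3)]] unfolding m(2) .
  moreover have "[int (fib (j + k)) = (-1) ^ Suc k * int (fib (Suc (Suc m)))] (mod int (fib j))"
    using 3(2)[OF Suc_leD[OF Suc_leD[OF 3(3)]]] unfolding m(1) .
  ultimately have "[int (fib (j + Suc k)) + int (fib (j + k)) =
      (-1) ^ Suc (Suc k) * int (fib (Suc m)) + (-1) ^ Suc k * int (fib (Suc (Suc m)))]
      (mod int (fib j))"
    by (rule cong_add)
  \<comment> \<open>Expanding \<open>fib (Suc (Suc m))\<close> cancels \<open>fib (Suc m)\<close>,
    as the two signs are opposite. What remains is \<open>fib m\<close> with the sign for
    \<open>k + 2\<close>.\<close>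
  then show ?case unfolding m(3) by (simp add: algebra_simps)
qed

lemma fib_shift_cong:
  assumes "j > 0"
  shows "[int (fib (2 * j + k)) = (-1) ^ j * int (fib k)] (mod int (fib j))"
proof (induction k rule: fib.induct)
  case 1
  show ?case using fib_reflect_cong[of j j] by (simp add: mult_2)
next
  case 2
  \<comment> \<open>\<open>fib (2 * j + 1)\<close> is the sum of the two reflected values at
    \<open>k = j - 1\<close> and \<open>k = j\<close>, which are \<open>(-1) ^ j\<close> and
    0.\<close>
  have "j - (j - 1) = 1" "Suc (j - 1) = j"
    using assms by auto
  then have "[int (fib (j + (j - 1))) = (-1) ^ j] (mod int (fib j))"
    using fib_reflect_cong[of "j - 1" j] by simp
  moreover have "[int (fib (j + j)) = 0] (mod int (fib j))"
    using fib_reflect_cong[of j j] by simp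
  ultimately have "[int (fib (j + (j - 1))) + int (fib (j + j)) = (-1) ^ j + 0] (mod int (fib j))"
    by (rule cong_add)
  moreover have "fib (2 * j + 1) = fib (j + (j - 1)) + fib (j + j)"
    using assms by (cases j) (simp_all add: mult_2 One_nat_def)
  ultimately show ?case by (simp add: One_nat_def)
next
  case (3 k)
  show ?case using cong_add[OF 3] by (simp add: algebra_simps)
qed

text \<open>The last step up to \<open>fib j\<close> adds \<open>fib (j - 2) > 0\<close>. The bound
  3 avoids the tie \<open>fib 1 = fib 2\<close>.\<close>

lemma fib_less_fib:
  assumes "k < j" "j \<ge> 3"
  shows "fib k < fib j"
proof -
  obtain m where m: "j = Suc (Suc m)" "m > 0"
    using assms by (intro that[of "j - 2"]) auto
  have "fib k \<le> fib (Suc m)" using assms m by (intro fib_mono) auto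
  with m fib_neq_0_nat[of m] show ?thesis by simp
qed

lemma two_le_fib:
  assumes "k \<ge> 3"
  shows "fib k \<ge> 2"
proof -
  have "fib 3 = 2" by (simp add: numeral_3_eq_3)
  then show ?thesis using fib_mono[OF assms] by simp
qed

section \<open>Residues at individual indices\<close>

lemma rho_eqI:
  assumes "[int (fib i) = v] (mod int m)" "0 \<le> v" "v < int m"
  shows "rho i m 1 = v"
  using assms by (simp add: rho_def cong_def)

lemma rho_less: "m > 0 \<Longrightarrow> rho i m e < int m"
  by (simp add: rho_def)

lemma rho_cong_iff: "rho i m 1 = rho k m 1 \<longleftrightarrow> [int (fib i) = int (fib k)] (mod int m)"
  by (simp add: rho_def cong_def)

lemma rho_below:
  assumes "i < j" "j \<ge> 3"
  shows "rho i (fib j) 1 = int (fib i)"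
  using fib_less_fib[OF assms] by (intro rho_eqI) auto

lemma rho_self: "rho j (fib j) 1 = 0"
  by (simp add: rho_def)

text \<open>The sign of the reflection depends on the parity of \<open>i - j\<close>; a negative
  value is brought into range by adding \<open>fib j\<close>. Comparing the parities of
  \<open>i\<close> and \<open>j\<close> serves even and odd \<open>j\<close> alike.\<close>

lemma rho_reflect:
  assumes "j < i" "i < 2 * j" "j \<ge> 3"
  shows "rho i (fib j) 1 =
    (if even i = even j then int (fib j) - int (fib (2 * j - i)) else int (fib (2 * j - i)))"
proof -
  define k where "k = i - j"
  have k: "i = j + k" "2 * j - i = j - k" "k \<le> j" "0 < k" "k < j"
    using assms by (auto simp: k_def)
  have bounds: "fib (j - k) < fib j" "fib (j - k) > 0"
    using fib_less_fib[of "j - k" j] fib_neq_0_nat[of "j - k"] k assms by auto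
  have cong: "[int (fib i) = (if even k then int (fib j) - int (fib (j - k))
      else int (fib (j - k)))] (mod int (fib j))"
  proof (cases "even k")
    case True
    have "[int (fib i) = - int (fib (j - k))] (mod int (fib j))"
      using fib_reflect_cong[OF k(3)] True k(1) by simp
    also have "[- int (fib (j - k)) = int (fib j) - int (fib (j - k))] (mod int (fib j))"
      by (simp add: cong_iff_dvd_diff)
    finally show ?thesis using True by simp
  next
    case False
    then show ?thesis using fib_reflect_cong[OF k(3)] k(1) by simp
  qed
  have parity: "even i = even j \<longleftrightarrow> even k"
    unfolding k(1) by (cases "even j") simp_all
  show ?thesis
    unfolding parity k(2) by (rule rho_eqI[OF cong]) (use bounds in auto)
qed

lemma rho_shift_even:
  assumes "even j" "j > 0"
  shows "rho (i + 2 * j) (fib j) 1 = rho i (fib j) 1"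
  using fib_shift_cong[of j i] assms unfolding rho_cong_iff by (simp add: add.commute)

lemma rho_shift_odd:
  assumes "odd j"
  shows "rho (i + 2 * j) (fib j) 1 = (- rho i (fib j) 1) mod int (fib j)"
  using fib_shift_cong[of j i] assms odd_pos[OF assms]
  by (simp add: rho_def cong_def mod_minus_eq add.commute)

text \<open>Negating a residue means subtracting it from the modulus, unless it is 0. This reduces
  indices from \<open>2 * j\<close> on to smaller ones.\<close>

lemma rho_shift_odd_if:
  assumes "odd j" "2 * j \<le> i"
  shows "rho i (fib j) 1 =
    (if rho (i - 2 * j) (fib j) 1 = 0 then 0 else int (fib j) - rho (i - 2 * j) (fib j) 1)"
proof -
  have "fib j > 0" using assms odd_pos[of j] fib_neq_0_nat[of j] by simp
  then have "0 \<le> rho (i - 2 * j) (fib j) 1" "rho (i - 2 * j) (fib j) 1 < int (fib j)"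
    by (simp_all add: rho_def)
  with rho_shift_odd[OF assms(1), of "i - 2 * j"] assms(2) show ?thesis
    by (simp add: zmod_zminus1_eq_if)
qed

text \<open>Two shifts by \<open>2 * j\<close> each change the sign.\<close>

lemma rho_period_odd:
  assumes "odd j"
  shows "rho (i + 4 * j) (fib j) 1 = rho i (fib j) 1"
proof -
  have "[int (fib (i + 4 * j)) = - int (fib (i + 2 * j))] (mod int (fib j))"
    using fib_shift_cong[of j "i + 2 * j"] assms odd_pos[OF assms] by (simp add: algebra_simps)
  also have "[- int (fib (i + 2 * j)) = int (fib i)] (mod int (fib j))"
    using fib_shift_cong[of j i] cong_minus_minus_iff[of "int (fib (i + 2 * j))" "- int (fib i)"]
      assms odd_pos[OF assms] by (simp add: add.commute)
  finally show ?thesis unfolding rho_cong_iff .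
qed

text \<open>A period is a zero of the residues, so this leaves \<open>j\<close> as the only
  candidate below \<open>2 * j\<close>.\<close>

lemma rho_pos_below:
  assumes "0 < i" "i < 2 * j" "i \<noteq> j" "j \<ge> 3"
  shows "0 < rho i (fib j) 1"
proof (cases "i < j")
  case True
  then show ?thesis using assms fib_neq_0_nat[of i] by (simp add: rho_below)
next
  case False
  then show ?thesis
    using assms rho_reflect[of j i] fib_less_fib[of "2 * j - i" j] fib_neq_0_nat[of "2 * j - i"]
    by auto
qed

section \<open>Minimal periods\<close>

lemma min_period_eqI:
  assumes "is_period a p" "\<And>q. is_period a q \<Longrightarrow> q < p \<Longrightarrow> False"
  shows "min_period a = p"
  unfolding min_period_def using assms by (intro Least_equality) (auto simp: not_less[symmetric])

text \<open>The initial residues 0 and 1 must recur at a period. These necessary conditions suffice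
  to rule out the smaller candidates.\<close>

lemma is_period_rhoD:
  assumes "is_period (\<lambda>i. rho i (fib j) 1) q" "j \<ge> 3"
  shows "0 < q" "rho q (fib j) 1 = 0" "rho (Suc q) (fib j) 1 = 1"
proof -
  have "rho (0 + q) (fib j) 1 = rho 0 (fib j) 1" "rho (1 + q) (fib j) 1 = rho 1 (fib j) 1"
    using assms(1) unfolding is_period_def by blast+
  then show "rho q (fib j) 1 = 0" "rho (Suc q) (fib j) 1 = 1"
    using rho_below[of 0 j] rho_below[of 1 j] assms(2) by (simp_all add: One_nat_def)
qed (use assms(1) in \<open>simp add: is_period_def\<close>)

text \<open>The residue after the zero at \<open>j\<close> is not 1, so \<open>j\<close> is not a
  period. For \<open>j = 3\<close> it would be \<open>fib 2 = 1\<close>.\<close>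

lemma rho_Suc_self:
  assumes "j \<ge> 4"
  shows "rho (Suc j) (fib j) 1 = int (fib (j - 1))" "fib (j - 1) \<ge> 2"
proof -
  show "rho (Suc j) (fib j) 1 = int (fib (j - 1))"
    using rho_reflect[of j "Suc j"] assms by (simp add: One_nat_def)
  show "fib (j - 1) \<ge> 2"
    using two_le_fib[of "j - 1"] assms by simp
qed

lemma is_period_rho_even:
  assumes "even j" "j > 0"
  shows "is_period (\<lambda>i. rho i (fib j) 1) (2 * j)"
  using assms rho_shift_even[of j] by (auto simp: is_period_def)

lemma is_period_rho_odd:
  assumes "odd j"
  shows "is_period (\<lambda>i. rho i (fib j) 1) (4 * j)"
  using odd_pos[OF assms] rho_period_odd[OF assms] by (auto simp: is_period_def)

lemma fib_period_even:
  assumes "even j" "j \<ge> 4"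
  shows "fib_period (fib j) 1 = 2 * j"
  unfolding fib_period_def
proof (rule min_period_eqI)
  fix q
  assume "is_period (\<lambda>i. rho i (fib j) 1) q" and less: "q < 2 * j"
  then have q: "0 < q" "rho q (fib j) 1 = 0" "rho (Suc q) (fib j) 1 = 1"
    using is_period_rhoD assms by simp_all
  then have "q = j" using rho_pos_below[of q j] less assms by fastforce
  then show False using q rho_Suc_self[of j] assms by simp
qed (use assms in \<open>auto intro!: is_period_rho_even\<close>)

lemma fib_period_odd:
  assumes "odd j" "j \<ge> 4"
  shows "fib_period (fib j) 1 = 4 * j"
  unfolding fib_period_def
proof (rule min_period_eqI)
  fix q
  assume "is_period (\<lambda>i. rho i (fib j) 1) q" and less: "q < 4 * j"
  then have q: "0 < q" "rho q (fib j) 1 = 0" "rho (Suc q) (fib j) 1 = 1"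
    using is_period_rhoD assms by simp_all
  \<comment> \<open>The bound 5 gives \<open>fib (j - 2) \<ge> 2\<close>, which separates
    \<open>fib (j - 1)\<close> from \<open>fib j - 1\<close> below.\<close>
  have j: "j \<ge> 5" using assms by (cases "j = 4") auto
  then have "j - 2 + 2 = j" "j - 2 + 1 = j - 1" "j - 2 \<ge> 3"
    by auto
  then have F: "fib j = fib (j - 1) + fib (j - 2)" "fib (j - 2) \<ge> 2"
    using fib_plus_2[of "j - 2"] two_le_fib[of "j - 2"] by metis+
  show False
  proof (cases "q < 2 * j")
    case True
    then have "q = j" using rho_pos_below[of q j] q assms by fastforce
    then show False using q rho_Suc_self[of j] assms by simp
  next
    case False
    \<comment> \<open>Going back by \<open>2 * j\<close> negates residues: the pair 0, 1 at
      \<open>q\<close> becomes 0, \<open>fib j - 1\<close> at \<open>r\<close>.\<close>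
    define r where "r = q - 2 * j"
    have r: "q - 2 * j = r" "Suc q - 2 * j = Suc r" "r < 2 * j"
      using False less by (auto simp: r_def)
    have "rho r (fib j) 1 = 0"
      using rho_shift_odd_if[of j q] rho_less[of "fib j" r 1] fib_neq_0_nat[of j] q False assms r
      by (simp split: if_splits)
    then have "r = 0 \<or> r = j" using rho_pos_below[of r j] r assms by fastforce
    moreover have "rho (Suc r) (fib j) 1 = int (fib j) - 1"
      using rho_shift_odd_if[of j "Suc q"] q False assms r by (simp split: if_splits)
    \<comment> \<open>The residue after \<open>r\<close> is 1 for \<open>r = 0\<close> and
      \<open>fib (j - 1)\<close> for \<open>r = j\<close>; both are smaller than
      \<open>fib j - 1\<close>.\<close>
    ultimately show False
      using rho_below[of "Suc 0" j] rho_Suc_self[of j] F assms by auto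
  qed
qed (use assms in \<open>auto intro!: is_period_rho_odd\<close>)

theorem theorem1:
  fixes j :: nat
  assumes "j \<ge> 4"
  shows
    "(even j \<longrightarrow>
        periodic (\<lambda>i. rho i (fib j) 1) \<and>
        fib_period (fib j) 1 = 2 * j \<and>
        (\<forall>i<2 * j.
           (i < j \<longrightarrow> rho i (fib j) 1 = int (fib i)) \<and>
           (i = j \<longrightarrow> rho i (fib j) 1 = 0) \<and>
           (j < i \<and> i < 2 * j \<and> odd i \<longrightarrow> rho i (fib j) 1 = int (fib (2 * j - i))) \<and>
           (j < i \<and> i < 2 * j \<and> even i \<longrightarrow>
              rho i (fib j) 1 = int (fib j) - int (fib (2 * j - i)))))
     \<and>
     (odd j \<longrightarrow>
        periodic (\<lambda>i. rho i (fib j) 1) \<and>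
        fib_period (fib j) 1 = 4 * j \<and>
        (\<forall>i<4 * j.
           (i < j \<longrightarrow> rho i (fib j) 1 = int (fib i)) \<and>
           (i = j \<longrightarrow> rho i (fib j) 1 = 0) \<and>
           (j < i \<and> i < 2 * j \<and> even i \<longrightarrow> rho i (fib j) 1 = int (fib (2 * j - i))) \<and>
           (j < i \<and> i < 2 * j \<and> odd i \<longrightarrow>
              rho i (fib j) 1 = int (fib j) - int (fib (2 * j - i))) \<and>
           (i = 2 * j \<longrightarrow> rho i (fib j) 1 = 0) \<and>
           (2 * j < i \<and> i < 3 * j \<longrightarrow>
              rho i (fib j) 1 = int (fib j) - int (fib (i - 2 * j))) \<and>
           (i = 3 * j \<longrightarrow> rho i (fib j) 1 = 0) \<and>
           (3 * j < i \<and> i < 4 * j \<and> even i \<longrightarrow>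
              rho i (fib j) 1 = int (fib j) - int (fib (4 * j - i))) \<and>
           (3 * j < i \<and> i < 4 * j \<and> odd i \<longrightarrow>
              rho i (fib j) 1 = int (fib (4 * j - i)))))"
proof -
  have periodic: "periodic (\<lambda>i. rho i (fib j) 1)"
    using is_period_rho_even[of j] is_period_rho_odd[of j] assms
    unfolding periodic_def by (cases "even j") auto
  have first: "rho i (fib j) 1 = int (fib i)" if "i < j" for i
    using rho_below[OF that] assms by simp
  have second: "rho i (fib j) 1 =
      (if even i = even j then int (fib j) - int (fib (2 * j - i)) else int (fib (2 * j - i)))"
    if "j < i" "i < 2 * j" for i
    using rho_reflect[OF that] assms by simp
  have double: "rho (2 * j) (fib j) 1 = 0" if "odd j"
    using rho_shift_odd_if[OF that, of "2 * j"] first[of 0] assms by simp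
  have third: "rho i (fib j) 1 = int (fib j) - int (fib (i - 2 * j))"
    if "odd j" "2 * j < i" "i < 3 * j" for i
    using rho_shift_odd_if[of j i] first[of "i - 2 * j"] fib_neq_0_nat[of "i - 2 * j"] that by simp
  have triple: "rho (3 * j) (fib j) 1 = 0" if "odd j"
    using rho_shift_odd_if[OF that, of "3 * j"] rho_self[of j] by simp
  have fourth: "rho i (fib j) 1 =
      (if even i then int (fib j) - int (fib (4 * j - i)) else int (fib (4 * j - i)))"
    if "odd j" "3 * j < i" "i < 4 * j" for i
  proof -
    \<comment> \<open>The index \<open>i - 2 * j\<close> has the parity of \<open>i\<close> and lies
      in the reflected range, where residues are positive; the shift then swaps the two reflected
      values.\<close>
    have *: "j < i - 2 * j" "i - 2 * j < 2 * j" "2 * j - (i - 2 * j) = 4 * j - i" "2 * j \<le> i"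
      using that by auto
    show ?thesis
      using rho_shift_odd_if[OF that(1) *(4)] second[OF *(1,2)] rho_pos_below[of "i - 2 * j" j]
        * that assms by auto
  qed
  show ?thesis
    using periodic fib_period_even[of j] fib_period_odd[of j] assms rho_self[of j]
    by (simp add: first second double third triple fourth)
qed

end
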